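(* Let $(X, \mathrm{d}\mu)$ be a $\sigma$-finite measure space. Suppose that $\alpha_1,\dots,\alpha_d > 0$ are such that $\sum_{j=1}^d \alpha_j = 1$. For each $j \in \{1, \dots , d\}$ let $\mathcal{G}_j$ be a saturating convex set of nonnegative measurable functions on $X$. Let $A\in[0,\infty)$ be a constant and assume that $$\int_X \prod_{j=1}^d g_{j}(x)^{\alpha_j}\, \mathrm{d} \mu(x) \leq A \quad\text{for all } g_1\in\mathcal{G}_1,\dots,g_d\in \mathcal{G}_d.$$ Then there exist nonnegative measurable functions $\phi_1,\dots,\phi_d$ on $X$ such that $$\prod_{j=1}^d \phi_j(x)^{\alpha_j} \geq 1$$ for almost every $x\in X$, and such that for every $j\in\{1,\dots,d\}$, $$\int_X g_{j}(x) \phi_j(x)\, \mathrm{d} \mu(x) \leq A\quad\text{for all } g_j\in \mathcal{G}_j.$$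
   Context: A set $\mathcal{G}$ of measurable functions on $(X,\mu)$ is called saturating if the functions vanish identically only on sets of measure zero: if $E\subseteq X$ is measurable and $f=0$ almost everywhere on $E$ for all $f\in \mathcal{G}$, then $\mu(E)=0$. Functions are real-valued. *)

theory Defs
  imports "HOL-Analysis.Analysis"
begin

definition saturating :: "'a measure \<Rightarrow> ('a \<Rightarrow> real) set \<Rightarrow> bool" where
  "saturating M G \<longleftrightarrow>
    (\<forall>E\<in>sets M. (\<forall>f\<in>G. AE x in M. x \<in> E \<longrightarrow> f x = 0) \<longrightarrow> emeasure M E = 0)"

(* The function type carries no real_vector instance, so the library's convex is not
   available; this is its defining condition with pointwise operations.  Functions on M are
   identified when they agree on space M: the values of a HOL function outside space M
   carry no meaning. *)
definition convex_functions :: "'a measure \<Rightarrow> ('a \<Rightarrow> real) set \<Rightarrow> bool" where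
  "convex_functions M G \<longleftrightarrow>
    (\<forall>f\<in>G. \<forall>g\<in>G. \<forall>u\<ge>0. \<forall>v\<ge>0. u + v = 1 \<longrightarrow>
      (\<exists>h\<in>G. \<forall>x\<in>space M. h x = u * f x + v * g x))"

definition nonneg_measurable :: "'a measure \<Rightarrow> ('a \<Rightarrow> real) set" where
  "nonneg_measurable M = {f \<in> borel_measurable M. \<forall>x\<in>space M. 0 \<le> f x}"

end

theory Submission
  imports Defs
begin

text \<open>
  Write \<open>J\<close> for the index set.  The proof has two halves.

  \<^emph>\<open>A maximiser yields factors.\<close>  Suppose that \<open>p\<close> maximises the concave functional
  \<open>F p = \<integral> \<Prod>j\<in>J. p j powr \<alpha> j\<close> over the product of the convex sets, and let
  \<open>\<phi> j = (\<Prod>k\<in>J. p k powr \<alpha> k) / p j\<close>.  Then \<open>\<Prod>j\<in>J. \<phi> j powr \<alpha> j = 1\<close> because the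
  exponents sum to one, and the first-order condition in the direction \<open>h - p j\<close> says exactly
  that \<open>\<integral> h * \<phi> j \<le> F p \<le> A\<close>.  A maximiser need not exist.  If, however, all functions that
  compete are comparable, \<open>h \<le> K * p\<close>, then the second-order error of the variation is
  controlled by \<open>K\<close>, so a near-maximiser is enough, at the price of \<open>A + \<epsilon>\<close> in place of \<open>A\<close>
  (\<open>near_maximiser_gives_factors\<close>).  Comparability is arranged by choosing \<open>g j \<in> G j\<close>, keeping
  only the \<open>h \<in> G j\<close> with \<open>h \<le> K * g j\<close>, and mixing in a small multiple of \<open>g j\<close>.  This shows
  that each set \<open>weak_factors\<close>, which asks for the inequalities with \<open>A + 1 / K\<close> for these \<open>h\<close>
  only, and for \<open>\<Prod>j\<in>J. \<phi> j powr \<alpha> j \<ge> 1\<close> only where every \<open>g j\<close> is positive, is nonempty.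

  \<^emph>\<open>Passage to the limit.\<close>  The sets \<open>weak_factors\<close> are convex and downward directed in
  \<open>(g, K)\<close>, but this family is in general uncountable, so a diagonal sequence does not exhaust it.
  The substitute for weak compactness is the minimisation of the strictly convex functional
  \<open>\<Psi> \<phi> = \<Sum>j\<in>J. \<integral> exp (- \<phi> j)\<close> with respect to an equivalent finite measure.  The infima
  of \<open>\<Psi>\<close> over the sets of the family have a supremum, and it is approached along a sequence of
  them.  The parallelogram-type identity
  \<open>(a\<^sup>2 + b\<^sup>2) / 2 - a * b = (a - b)\<^sup>2 / 2\<close> with \<open>a = exp (- \<phi> / 2)\<close>, \<open>b = exp (- \<psi> / 2)\<close>
  then shows that near-minimisers over \<^emph>\<open>any\<close> sufficiently small member of the family are close in
  mean square.  So one function \<open>u\<close> is an almost everywhere limit of \<open>exp (- \<phi> / 2)\<close> along some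
  sequence in each member (\<open>directed_convex_family_common_limit\<close>).

  The factors are \<open>- 2 * ln u\<close>.  By Fatou's lemma they satisfy every inequality that defines the
  weak factors, and letting \<open>K\<close> tend to infinity gives the constant \<open>A\<close>.  Saturation enters twice:
  it makes the limit finite almost everywhere, and it shows that the sets on which every \<open>g j\<close>
  is positive cover almost all of the space (\<open>saturating_joint_support\<close>).
\<close>

section \<open>Factors from a near-maximiser\<close>

lemma one_plus_powr_lower:
  fixes a y :: real
  assumes "a > 0" "\<bar>y\<bar> \<le> 1/2"
  shows "1 + a * y - 2 * a * y\<^sup>2 \<le> (1 + y) powr a"
proof -
  have ln: "y - 2 * y\<^sup>2 \<le> ln (1 + y)"
    using abs_ln_one_plus_x_minus_x_bound[OF assms(2)] by linarith
  have "1 + a * (y - 2 * y\<^sup>2) \<le> 1 + a * ln (1 + y)"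
    using ln assms(1) by simp
  also have "\<dots> \<le> exp (a * ln (1 + y))" by (rule exp_ge_add_one_self)
  also have "\<dots> = (1 + y) powr a" using assms(2) by (simp add: powr_def abs_le_iff)
  finally show ?thesis by (simp add: algebra_simps)
qed

lemma prod_powr_upd:
  fixes p :: "'i \<Rightarrow> 'a \<Rightarrow> real"
  assumes "finite J" "j \<in> J" "p j x > 0" "0 \<le> c"
    and "q x = c * p j x"
  shows "(\<Prod>k\<in>J. (p(j := q)) k x powr \<alpha> k) = c powr \<alpha> j * (\<Prod>k\<in>J. p k x powr \<alpha> k)"
proof -
  have "(\<Prod>k\<in>J - {j}. (p(j := q)) k x powr \<alpha> k) = (\<Prod>k\<in>J - {j}. p k x powr \<alpha> k)"
    by (intro prod.cong) auto
  then show ?thesis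
    using assms by (simp add: prod.remove[of J j] powr_mult mult_ac)
qed

text \<open>
  This is the first-order condition in quantitative form.  Replacing \<open>p j\<close> by
  \<open>(1 - t) * p j + t * h\<close> changes the functional by
  \<open>t * \<alpha> j * (\<integral> h * \<phi> j - F p)\<close> up to an error of order \<open>(t * K)\<^sup>2 * A\<close>, where the
  comparability \<open>h \<le> K * p j\<close> bounds the quadratic term uniformly in \<open>p\<close> and \<open>h\<close>.  If \<open>p\<close> is
  within \<open>\<eta>\<close> of the supremum, the change is at most \<open>\<eta>\<close>; choosing first \<open>t\<close> and then \<open>\<eta>\<close>
  small makes the loss at most \<open>\<epsilon>\<close>.  The product is divided by \<open>p j x\<close> also where that value
  is zero; there both product and quotient vanish.
\<close>

lemma near_maximiser_gives_factors:
  fixes H :: "'i \<Rightarrow> ('a \<Rightarrow> real) set" and \<alpha> :: "'i \<Rightarrow> real"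
  assumes J: "finite J" and \<alpha>: "\<And>j. j \<in> J \<Longrightarrow> \<alpha> j > 0"
    and H: "\<And>j. j \<in> J \<Longrightarrow> H j \<subseteq> nonneg_measurable M"
    and conv: "\<And>j. j \<in> J \<Longrightarrow> convex_functions M (H j)"
    and ne: "\<And>j. j \<in> J \<Longrightarrow> H j \<noteq> {}"
    and K: "K \<ge> 1"
    and comp: "\<And>j p h x. \<lbrakk>j \<in> J; p \<in> H j; h \<in> H j; x \<in> space M\<rbrakk> \<Longrightarrow> h x \<le> K * p x"
    and bound: "\<And>p. (\<And>j. j \<in> J \<Longrightarrow> p j \<in> H j) \<Longrightarrow>
      (\<integral>\<^sup>+ x. ennreal (\<Prod>j\<in>J. p j x powr \<alpha> j) \<partial>M) \<le> ennreal A"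
    and A: "A \<ge> 0" and \<epsilon>: "\<epsilon> > 0"
  obtains p where "\<And>j. j \<in> J \<Longrightarrow> p j \<in> H j"
    "\<And>j h. \<lbrakk>j \<in> J; h \<in> H j\<rbrakk> \<Longrightarrow>
      (\<integral>\<^sup>+ x. ennreal (h x * ((\<Prod>k\<in>J. p k x powr \<alpha> k) / p j x)) \<partial>M) \<le> ennreal (A + \<epsilon>)"
proof -
  define P where "P p x = (\<Prod>k\<in>J. p k x powr \<alpha> k)" for p :: "'i \<Rightarrow> 'a \<Rightarrow> real" and x
  define F where "F p = (\<integral>x. P p x \<partial>M)" for p
  define S where "S = {p. \<forall>j\<in>J. p j \<in> H j}"
  have meas: "p j \<in> borel_measurable M" if "p \<in> S" "j \<in> J" for p j
    using that H unfolding S_def nonneg_measurable_def by blast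
  have nn: "0 \<le> p j x" if "p \<in> S" "j \<in> J" "x \<in> space M" for p j x
    using that H unfolding S_def nonneg_measurable_def by blast
  have P0: "0 \<le> P p x" for p x
    unfolding P_def by (intro prod_nonneg) auto
  have Pm: "P p \<in> borel_measurable M" if "p \<in> S" for p
    unfolding P_def using meas[OF that] by measurable
  have int: "integrable M (P p)" if "p \<in> S" for p
    using bound[of p] that Pm[OF that] P0
    by (intro integrableI_nonneg) (auto simp: S_def P_def[symmetric] top_unique less_top[symmetric])
  have FA: "F p \<le> A" if "p \<in> S" for p
  proof -
    have "ennreal (F p) \<le> ennreal A"
      unfolding F_def using bound[of p] that int[OF that] P0
      by (subst nn_integral_eq_integral[symmetric]) (auto simp: S_def P_def)
    then show ?thesis using A by simp
  qed
  have "S \<noteq> {}"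
  proof -
    have "(\<lambda>j. SOME h. h \<in> H j) \<in> S" using ne by (auto simp: S_def some_in_eq)
    then show ?thesis by blast
  qed
  define s where "s = (SUP p\<in>S. F p)"
  have bdd: "bdd_above (F ` S)" by (rule bdd_aboveI2) (rule FA)
  obtain a where a: "a > 0" "\<And>j. j \<in> J \<Longrightarrow> a \<le> \<alpha> j"
  proof (cases "J = {}")
    case True then show ?thesis using that[of 1] by auto
  next
    case False then show ?thesis using that[of "Min (\<alpha> ` J)"] J \<alpha> by auto
  qed
  \<comment> \<open>The first bound keeps the variation in the range of the logarithmic estimate, the second makes
    the quadratic error, relative to \<open>\<alpha> j * t\<close>, at most \<open>\<epsilon> / 2\<close>.\<close>
  define t where "t = min (1 / (2 * K)) (\<epsilon> / (4 * K\<^sup>2 * (A + 1)))"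
  have t: "0 < t" "t * K \<le> 1/2" "2 * t * K\<^sup>2 * A \<le> \<epsilon> / 2" "t \<le> 1"
  proof -
    show "0 < t" using K A \<epsilon> by (auto simp: t_def)
    have "t \<le> 1 / (2 * K)" by (simp add: t_def)
    then show tK: "t * K \<le> 1/2" using K by (simp add: field_simps)
    have "t * 1 \<le> t * K" using K \<open>0 < t\<close> by (intro mult_left_mono) auto
    with tK show "t \<le> 1" by simp
    have "t \<le> \<epsilon> / (4 * K\<^sup>2 * (A + 1))" by (simp add: t_def)
    moreover have "4 * K\<^sup>2 * (A + 1) > 0" using K A by simp
    ultimately have "t * (4 * K\<^sup>2 * (A + 1)) \<le> \<epsilon>" by (simp only: pos_le_divide_eq)
    moreover have "0 \<le> 4 * t * K\<^sup>2" using \<open>0 < t\<close> by simp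
    ultimately show "2 * t * K\<^sup>2 * A \<le> \<epsilon> / 2" by (simp add: algebra_simps)
  qed
  \<comment> \<open>The factor \<open>t\<close> lets the deficit of the near-maximiser survive the division by
    \<open>\<alpha> j * t\<close>.\<close>
  define \<eta> where "\<eta> = a * t * \<epsilon> / 2"
  have "\<eta> > 0" using a t \<epsilon> by (simp add: \<eta>_def)
  then obtain p where p: "p \<in> S" "s - \<eta> < F p"
    using less_cSUP_iff[OF \<open>S \<noteq> {}\<close> bdd, of "s - \<eta>"] unfolding s_def by auto
  have main: "(\<integral>\<^sup>+ x. ennreal (h x * (P p x / p j x)) \<partial>M) \<le> ennreal (A + \<epsilon>)"
    if j: "j \<in> J" and h: "h \<in> H j" for j h
  proof -
    have pj: "p j \<in> H j" using p j by (simp add: S_def)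
    have h0: "0 \<le> h x" if "x \<in> space M" for x
      using h H[OF j] that unfolding nonneg_measurable_def by blast
    have hm: "h \<in> borel_measurable M"
      using h H[OF j] unfolding nonneg_measurable_def by blast
    have "\<exists>q\<in>H j. \<forall>x\<in>space M. q x = (1 - t) * p j x + t * h x"
      using conv[OF j, unfolded convex_functions_def, rule_format, OF pj h, of "1 - t" t] t by simp
    then obtain q where q: "q \<in> H j" "\<And>x. x \<in> space M \<Longrightarrow> q x = (1 - t) * p j x + t * h x"
      by blast
    define p' where "p' = p(j := q)"
    have p': "p' \<in> S" using p(1) q(1) by (auto simp: S_def p'_def)
    define R where "R x = h x * (P p x / p j x)" for x
    have R0: "0 \<le> R x" if "x \<in> space M" for x
      unfolding R_def using P0 nn[OF p(1) j that] h0[OF that] by simp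
    have Rm: "R \<in> borel_measurable M"
      unfolding R_def using hm meas[OF p(1) j] Pm[OF p(1)] by measurable
    \<comment> \<open>The pointwise form of the expansion; integrating it gives the estimate, and it also shows
      that \<open>R\<close> is integrable.\<close>
    have key: "\<alpha> j * t * R x \<le> P p' x - P p x + \<alpha> j * t * P p x + 2 * \<alpha> j * (t * K)\<^sup>2 * P p x"
      if x: "x \<in> space M" for x
    proof (cases "P p x = 0")
      case True then show ?thesis using P0 by (simp add: R_def)
    next
      case False
      then have "p j x \<noteq> 0" using J j by (auto simp: P_def)
      then have pos: "p j x > 0" using nn[OF p(1) j x] by simp
      define r where "r = h x / p j x"
      have r: "0 \<le> r" "r \<le> K"
        using h0[OF x] pos comp[OF j pj h x] by (auto simp: r_def field_simps)
      define y where "y = t * (r - 1)"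
      have "\<bar>r - 1\<bar> \<le> K" using r K by linarith
      then have y: "\<bar>y\<bar> \<le> t * K" using t by (simp add: y_def abs_mult)
      have qx: "q x = (1 + y) * p j x"
        using pos by (simp add: q(2)[OF x] y_def r_def field_simps)
      have y2: "y\<^sup>2 \<le> (t * K)\<^sup>2" using y by (metis abs_ge_zero power2_abs power_mono)
      have "P p' x = (1 + y) powr \<alpha> j * P p x"
        unfolding P_def p'_def using J j pos qx y t by (intro prod_powr_upd) auto
      moreover have "1 + \<alpha> j * y - 2 * \<alpha> j * (t * K)\<^sup>2 \<le> (1 + y) powr \<alpha> j"
      proof -
        have "2 * \<alpha> j * y\<^sup>2 \<le> 2 * \<alpha> j * (t * K)\<^sup>2"
          using y2 \<alpha>[OF j] by (intro mult_left_mono) auto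
        then show ?thesis using one_plus_powr_lower[OF \<alpha>[OF j], of y] y t by linarith
      qed
      ultimately have "(1 + \<alpha> j * y - 2 * \<alpha> j * (t * K)\<^sup>2) * P p x \<le> P p' x"
        using P0[of p x] by (simp add: mult_right_mono)
      moreover have "R x = r * P p x" by (simp add: R_def r_def)
      ultimately show ?thesis by (simp add: y_def algebra_simps)
    qed
    have intR: "integrable M (\<lambda>x. \<alpha> j * t * R x)"
    proof (rule Bochner_Integration.integrable_bound)
      show "integrable M (\<lambda>x. P p' x - P p x + \<alpha> j * t * P p x + 2 * \<alpha> j * (t * K)\<^sup>2 * P p x)"
        using int[OF p'] int[OF p(1)] by simp
      show "AE x in M. norm (\<alpha> j * t * R x)
          \<le> norm (P p' x - P p x + \<alpha> j * t * P p x + 2 * \<alpha> j * (t * K)\<^sup>2 * P p x)"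
      proof (rule AE_I2)
        fix x assume x: "x \<in> space M"
        have "0 \<le> \<alpha> j * t * R x" using \<alpha>[OF j] t R0[OF x] by simp
        then show "norm (\<alpha> j * t * R x)
          \<le> norm (P p' x - P p x + \<alpha> j * t * P p x + 2 * \<alpha> j * (t * K)\<^sup>2 * P p x)"
          using key[OF x] by simp
      qed
    qed (use Rm in measurable)
    have "\<alpha> j * t * (\<integral>x. R x \<partial>M)
        \<le> (\<integral>x. P p' x - P p x + \<alpha> j * t * P p x + 2 * \<alpha> j * (t * K)\<^sup>2 * P p x \<partial>M)"
      using integral_mono[OF intR _ key] int[OF p'] int[OF p(1)] by simp
    also have "\<dots> = F p' - F p + \<alpha> j * t * F p + 2 * \<alpha> j * (t * K)\<^sup>2 * F p"
      using int[OF p'] int[OF p(1)] by (simp add: F_def)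
    also have "\<dots> \<le> \<alpha> j * t * (\<epsilon> / 2) + \<alpha> j * t * A + \<alpha> j * t * (\<epsilon> / 2)"
    proof -
      have "F p' \<le> s" unfolding s_def by (rule cSUP_upper[OF p' bdd])
      then have "F p' - F p \<le> \<eta>" using p(2) by linarith
      also have "\<eta> \<le> \<alpha> j * t * (\<epsilon> / 2)"
        using a(2)[OF j] t \<epsilon> by (simp add: \<eta>_def)
      finally have 1: "F p' - F p \<le> \<alpha> j * t * (\<epsilon> / 2)" .
      have 2: "\<alpha> j * t * F p \<le> \<alpha> j * t * A"
        using FA[OF p(1)] \<alpha>[OF j] t by (intro mult_left_mono) auto
      have "2 * \<alpha> j * (t * K)\<^sup>2 * F p \<le> 2 * \<alpha> j * (t * K)\<^sup>2 * A"
        using FA[OF p(1)] \<alpha>[OF j] t by (intro mult_left_mono) auto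
      also have "\<dots> = \<alpha> j * t * (2 * t * K\<^sup>2 * A)" by (simp add: power2_eq_square)
      also have "\<dots> \<le> \<alpha> j * t * (\<epsilon> / 2)"
        using t \<alpha>[OF j] by (intro mult_left_mono) auto
      finally show ?thesis using 1 2 by linarith
    qed
    also have "\<dots> = \<alpha> j * t * (A + \<epsilon>)" by (simp add: algebra_simps)
    finally have "(\<integral>x. R x \<partial>M) \<le> A + \<epsilon>" using \<alpha>[OF j] t by simp
    moreover have "integrable M R" using intR \<alpha>[OF j] t by simp
    ultimately show ?thesis
      using R0 A \<epsilon> unfolding R_def[symmetric]
      by (subst nn_integral_eq_integral) (auto intro: ennreal_leI simp del: ennreal_plus)
  qed
  show thesis
    using that[of p] p(1) main by (auto simp: S_def P_def)
qed

section \<open>Weak factors\<close>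

text \<open>
  The pair \<open>(g, K)\<close> measures how much of the conclusion is demanded.  Testing against all \<open>h\<close>
  dominated by \<open>K * g j\<close>, rather than against \<open>g j\<close> alone, makes the sets
  downward directed: the midpoint of \<open>g\<close> and \<open>g'\<close> dominates half of either, which a doubling of
  \<open>K\<close> absorbs.
\<close>

definition weak_factors ::
  "'a measure \<Rightarrow> 'i set \<Rightarrow> ('i \<Rightarrow> real) \<Rightarrow> ('i \<Rightarrow> ('a \<Rightarrow> real) set) \<Rightarrow> real
    \<Rightarrow> ('i \<Rightarrow> 'a \<Rightarrow> real) \<Rightarrow> real \<Rightarrow> ('i \<Rightarrow> 'a \<Rightarrow> real) set" where
  "weak_factors M J \<alpha> G A g K = {\<phi>.
    (\<forall>j\<in>J. \<phi> j \<in> nonneg_measurable M) \<and>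
    (\<forall>x\<in>space M. (\<forall>j\<in>J. 0 < g j x) \<longrightarrow> 1 \<le> (\<Prod>j\<in>J. \<phi> j x powr \<alpha> j)) \<and>
    (\<forall>j\<in>J. \<forall>h\<in>G j. (\<forall>x\<in>space M. h x \<le> K * g j x) \<longrightarrow>
      (\<integral>\<^sup>+ x. ennreal (h x * \<phi> j x) \<partial>M) \<le> ennreal (A + 1 / K))}"

text \<open>
  The near-maximiser is taken over the functions \<open>(1 - \<delta>) * h + \<delta> * g j\<close> with \<open>h \<le> K * g j\<close>.
  They all lie between \<open>\<delta> * g j\<close> and \<open>K * g j\<close>, hence are comparable with constant \<open>K / \<delta>\<close>.
  Since \<open>(1 - \<delta>) * h\<close> is below the competitor built from \<open>h\<close>, the bound for the competitor gives
  one for \<open>h\<close> with a loss of the factor \<open>1 / (1 - \<delta>)\<close>.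
\<close>

lemma weak_factors_nonempty:
  assumes J: "finite J" and \<alpha>: "\<And>j. j \<in> J \<Longrightarrow> \<alpha> j > 0" "sum \<alpha> J = 1"
    and G: "\<And>j. j \<in> J \<Longrightarrow> G j \<subseteq> nonneg_measurable M"
    and conv: "\<And>j. j \<in> J \<Longrightarrow> convex_functions M (G j)"
    and bound: "\<And>g. (\<And>j. j \<in> J \<Longrightarrow> g j \<in> G j) \<Longrightarrow>
      (\<integral>\<^sup>+ x. ennreal (\<Prod>j\<in>J. g j x powr \<alpha> j) \<partial>M) \<le> ennreal A"
    and A: "A \<ge> 0" and g: "\<And>j. j \<in> J \<Longrightarrow> g j \<in> G j" and K: "K \<ge> 1"
  shows "weak_factors M J \<alpha> G A g K \<noteq> {}"
proof -
  \<comment> \<open>The allowance \<open>1 / K\<close> pays for both losses: \<open>\<delta>\<close> is the solution of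
    \<open>(A + \<epsilon>) / (1 - \<delta>) = A + 1 / K\<close>.\<close>
  define \<epsilon> where "\<epsilon> = 1 / (2 * K)"
  define \<delta> where "\<delta> = \<epsilon> / (A + 1 / K)"
  have AK: "A + 1 / K > 0" using A K by (simp add: add_nonneg_pos)
  have \<epsilon>: "\<epsilon> > 0" using K by (simp add: \<epsilon>_def)
  have "\<delta> > 0" using \<epsilon> AK by (simp add: \<delta>_def)
  have "1 / (2 * K) < 1 / K" using K by (simp add: field_simps)
  then have "\<epsilon> < A + 1 / K" using A by (simp add: \<epsilon>_def)
  then have "\<delta> < 1" using AK by (simp add: \<delta>_def)
  have \<delta>A: "A + \<epsilon> = (1 - \<delta>) * (A + 1 / K)"
    using AK by (simp add: \<delta>_def \<epsilon>_def left_diff_distrib)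
  define H where "H j = {p \<in> G j. \<exists>h\<in>G j. \<forall>x\<in>space M. h x \<le> K * g j x \<and>
    p x = (1 - \<delta>) * h x + \<delta> * g j x}" for j
  have nn: "0 \<le> h x" if "j \<in> J" "h \<in> G j" "x \<in> space M" for j h x
    using that G unfolding nonneg_measurable_def by blast
  have H_I: "\<exists>p\<in>H j. \<forall>x\<in>space M. p x = (1 - \<delta>) * h x + \<delta> * g j x"
    if j: "j \<in> J" and h: "h \<in> G j" "\<And>x. x \<in> space M \<Longrightarrow> h x \<le> K * g j x" for j h
  proof -
    have "\<exists>p\<in>G j. \<forall>x\<in>space M. p x = (1 - \<delta>) * h x + \<delta> * g j x"
      using conv[OF j, unfolded convex_functions_def, rule_format, OF h(1) g[OF j], of "1 - \<delta>" \<delta>]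
        \<open>\<delta> > 0\<close> \<open>\<delta> < 1\<close> by simp
    then show ?thesis using h unfolding H_def by blast
  qed
  have H_bounds: "\<delta> * g j x \<le> p x" "p x \<le> K * g j x"
    if j: "j \<in> J" and p: "p \<in> H j" and x: "x \<in> space M" for j p x
  proof -
    obtain h where h: "h \<in> G j" "h x \<le> K * g j x" "p x = (1 - \<delta>) * h x + \<delta> * g j x"
      using p x unfolding H_def by blast
    have "0 \<le> (1 - \<delta>) * h x" using nn[OF j h(1) x] \<open>\<delta> < 1\<close> by simp
    then show "\<delta> * g j x \<le> p x" using h(3) by simp
    have "g j x \<le> K * g j x" using K nn[OF j g[OF j] x] by (simp add: mult_le_cancel_right1)
    then have "(1 - \<delta>) * h x + \<delta> * g j x \<le> (1 - \<delta>) * (K * g j x) + \<delta> * (K * g j x)"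
      using h(2) \<open>\<delta> > 0\<close> \<open>\<delta> < 1\<close> by (intro add_mono mult_left_mono) auto
    then show "p x \<le> K * g j x" using h(3) by (simp add: algebra_simps)
  qed
  have H_conv: "convex_functions M (H j)" if j: "j \<in> J" for j
    unfolding convex_functions_def
  proof (intro ballI allI impI)
    fix p q and a b :: real
    assume pq: "p \<in> H j" "q \<in> H j" and ab: "0 \<le> a" "0 \<le> b" "a + b = 1"
    obtain hp where hp: "hp \<in> G j" "\<forall>x\<in>space M. hp x \<le> K * g j x \<and> p x = (1 - \<delta>) * hp x + \<delta> * g j x"
      using pq(1) unfolding H_def by blast
    obtain hq where hq: "hq \<in> G j" "\<forall>x\<in>space M. hq x \<le> K * g j x \<and> q x = (1 - \<delta>) * hq x + \<delta> * g j x"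
      using pq(2) unfolding H_def by blast
    obtain h where h: "h \<in> G j" "\<forall>x\<in>space M. h x = a * hp x + b * hq x"
      using conv[OF j] hp(1) hq(1) ab unfolding convex_functions_def by blast
    have "h x \<le> K * g j x" if x: "x \<in> space M" for x
    proof -
      have "a * hp x + b * hq x \<le> a * (K * g j x) + b * (K * g j x)"
        using hp(2) hq(2) ab x by (intro add_mono mult_left_mono) auto
      also have "\<dots> = K * g j x" using ab(3) by (simp flip: distrib_right)
      finally show ?thesis using h(2) x by simp
    qed
    from H_I[OF j h(1) this] obtain r
      where r: "r \<in> H j" "\<forall>x\<in>space M. r x = (1 - \<delta>) * h x + \<delta> * g j x" by blast
    have "r x = a * p x + b * q x" if x: "x \<in> space M" for x
    proof -
      have vals: "r x = (1 - \<delta>) * (a * hp x + b * hq x) + \<delta> * g j x"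
          "p x = (1 - \<delta>) * hp x + \<delta> * g j x" "q x = (1 - \<delta>) * hq x + \<delta> * g j x"
        using r(2) h(2) hp(2) hq(2) x by simp_all
      have "r x - (a * p x + b * q x) = (1 - (a + b)) * (\<delta> * g j x)"
        unfolding vals by (simp add: algebra_simps)
      then show ?thesis using ab(3) by simp
    qed
    then show "\<exists>h\<in>H j. \<forall>x\<in>space M. h x = a * p x + b * q x" using r(1) by blast
  qed
  have HG: "H j \<subseteq> G j" for j by (auto simp: H_def)
  obtain p where p: "\<And>j. j \<in> J \<Longrightarrow> p j \<in> H j"
    and opt: "\<And>j h. \<lbrakk>j \<in> J; h \<in> H j\<rbrakk> \<Longrightarrow>
      (\<integral>\<^sup>+ x. ennreal (h x * ((\<Prod>k\<in>J. p k x powr \<alpha> k) / p j x)) \<partial>M) \<le> ennreal (A + \<epsilon>)"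
  proof (rule near_maximiser_gives_factors[where J = J and \<alpha> = \<alpha> and H = H and M = M
        and K = "K / \<delta>" and A = A and \<epsilon> = \<epsilon>])
    show "H j \<subseteq> nonneg_measurable M" if "j \<in> J" for j using HG G[OF that] by blast
    show "H j \<noteq> {}" if j: "j \<in> J" for j
    proof -
      have "g j x \<le> K * g j x" if "x \<in> space M" for x
        using K nn[OF j g[OF j] that] by (simp add: mult_le_cancel_right1)
      then show ?thesis using H_I[OF j g[OF j]] by blast
    qed
    show "1 \<le> K / \<delta>" using K \<open>\<delta> > 0\<close> \<open>\<delta> < 1\<close> by simp
    show "h x \<le> K / \<delta> * p x" if "j \<in> J" "p \<in> H j" "h \<in> H j" "x \<in> space M" for j p h x
    proof -
      have "h x \<le> (K / \<delta>) * (\<delta> * g j x)" using H_bounds(2)[OF that(1,3,4)] \<open>\<delta> > 0\<close> by simp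
      also have "\<dots> \<le> K / \<delta> * p x"
        using H_bounds(1)[OF that(1,2,4)] K \<open>\<delta> > 0\<close> by (intro mult_left_mono) auto
      finally show ?thesis .
    qed
  qed (use J \<alpha> H_conv A \<epsilon> bound HG in blast)+
  define \<phi> where "\<phi> j x = (\<Prod>k\<in>J. p k x powr \<alpha> k) / p j x" for j x
  have p_nn: "0 \<le> p j x" if "j \<in> J" "x \<in> space M" for j x
    using p HG nn that by blast
  have p_m: "p j \<in> borel_measurable M" if "j \<in> J" for j
    using p[OF that] HG G[OF that] unfolding nonneg_measurable_def by blast
  have "\<phi> \<in> weak_factors M J \<alpha> G A g K"
    unfolding weak_factors_def mem_Collect_eq
  proof (intro conjI ballI impI)
    fix j assume j: "j \<in> J"
    show "\<phi> j \<in> nonneg_measurable M"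
      unfolding nonneg_measurable_def mem_Collect_eq \<phi>_def
    proof
      show "(\<lambda>x. (\<Prod>k\<in>J. p k x powr \<alpha> k) / p j x) \<in> borel_measurable M"
        using p_m j by measurable
      show "\<forall>x\<in>space M. 0 \<le> (\<Prod>k\<in>J. p k x powr \<alpha> k) / p j x"
        using p_nn j by (auto intro!: divide_nonneg_nonneg prod_nonneg)
    qed
  next
    fix x assume x: "x \<in> space M" and pos: "\<forall>j\<in>J. 0 < g j x"
    have pp: "p j x > 0" if "j \<in> J" for j
    proof -
      have "0 < \<delta> * g j x" using pos that \<open>\<delta> > 0\<close> by simp
      then show ?thesis using H_bounds(1)[OF that p[OF that] x] by linarith
    qed
    define Q where "Q = (\<Prod>k\<in>J. p k x powr \<alpha> k)"
    have Q: "Q > 0" unfolding Q_def using pp by (intro prod_pos) force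
    have "(\<Prod>j\<in>J. \<phi> j x powr \<alpha> j) = (\<Prod>j\<in>J. Q powr \<alpha> j / p j x powr \<alpha> j)"
      using pp Q by (intro prod.cong) (auto simp: \<phi>_def Q_def[symmetric] powr_divide)
    also have "\<dots> = (\<Prod>j\<in>J. Q powr \<alpha> j) / Q" by (simp add: prod_dividef Q_def)
    also have "(\<Prod>j\<in>J. Q powr \<alpha> j) = Q" using Q \<alpha>(2) J by (simp add: powr_sum[symmetric])
    finally show "1 \<le> (\<Prod>j\<in>J. \<phi> j x powr \<alpha> j)" using Q by simp
  next
    fix j h assume j: "j \<in> J" and h: "h \<in> G j" and le: "\<forall>x\<in>space M. h x \<le> K * g j x"
    have \<phi>m: "\<phi> j \<in> borel_measurable M"
      unfolding \<phi>_def using p_m j by measurable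
    have \<phi>0: "0 \<le> \<phi> j x" if "x \<in> space M" for x
      unfolding \<phi>_def using p_nn j that by (auto intro!: divide_nonneg_nonneg prod_nonneg)
    have hm: "h \<in> borel_measurable M"
      using h G[OF j] unfolding nonneg_measurable_def by blast
    obtain q where q: "q \<in> H j" "\<forall>x\<in>space M. q x = (1 - \<delta>) * h x + \<delta> * g j x"
      using H_I[OF j h] le by blast
    have "ennreal (1 - \<delta>) * (\<integral>\<^sup>+ x. ennreal (h x * \<phi> j x) \<partial>M)
        = (\<integral>\<^sup>+ x. ennreal ((1 - \<delta>) * (h x * \<phi> j x)) \<partial>M)"
      using \<open>\<delta> < 1\<close> hm \<phi>m nn[OF j h] \<phi>0
      by (subst nn_integral_cmult[symmetric]) (auto intro!: nn_integral_cong simp: ennreal_mult')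
    also have "\<dots> \<le> (\<integral>\<^sup>+ x. ennreal (q x * \<phi> j x) \<partial>M)"
    proof (rule nn_integral_mono)
      fix x assume x: "x \<in> space M"
      have "(1 - \<delta>) * h x \<le> q x"
        using q(2) x nn[OF j g[OF j] x] \<open>\<delta> > 0\<close> by simp
      then show "ennreal ((1 - \<delta>) * (h x * \<phi> j x)) \<le> ennreal (q x * \<phi> j x)"
        using mult_right_mono[OF _ \<phi>0[OF x]] by (intro ennreal_leI) (simp flip: mult.assoc)
    qed
    also have "\<dots> \<le> ennreal (A + \<epsilon>)" using opt[OF j q(1)] by (simp add: \<phi>_def)
    also have "\<dots> = ennreal (1 - \<delta>) * ennreal (A + 1 / K)"
      using \<delta>A \<open>\<delta> < 1\<close> AK by (simp only: ennreal_mult[symmetric])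
    finally show "(\<integral>\<^sup>+ x. ennreal (h x * \<phi> j x) \<partial>M) \<le> ennreal (A + 1 / K)"
      using \<open>\<delta> < 1\<close> by (subst (asm) ennreal_mult_le_mult_iff) auto
  qed
  then show ?thesis by blast
qed

text \<open>
  Superlevel sets of the weighted geometric mean are convex; for midpoints this follows from
  \<open>(a + b) / 2 \<ge> sqrt (a * b)\<close> in each coordinate.
\<close>

lemma prod_powr_midpoint_ge_1:
  fixes a b :: "'i \<Rightarrow> real"
  assumes "\<And>j. j \<in> J \<Longrightarrow> \<alpha> j > 0" "\<And>j. j \<in> J \<Longrightarrow> 0 \<le> a j" "\<And>j. j \<in> J \<Longrightarrow> 0 \<le> b j"
    and "1 \<le> (\<Prod>j\<in>J. a j powr \<alpha> j)" "1 \<le> (\<Prod>j\<in>J. b j powr \<alpha> j)"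
  shows "1 \<le> (\<Prod>j\<in>J. ((a j + b j) / 2) powr \<alpha> j)"
proof -
  have "1 \<le> sqrt ((\<Prod>j\<in>J. a j powr \<alpha> j) * (\<Prod>j\<in>J. b j powr \<alpha> j))"
    using mult_mono[OF assms(4,5)] assms(4) by simp
  also have "\<dots> = (\<Prod>j\<in>J. (sqrt (a j * b j)) powr \<alpha> j)"
  proof -
    have "sqrt (a j powr \<alpha> j * b j powr \<alpha> j) = (sqrt (a j * b j)) powr \<alpha> j" if "j \<in> J" for j
      using assms(2,3)[OF that] by (simp add: powr_half_sqrt[symmetric] powr_powr powr_mult mult.commute)
    moreover have "sqrt (\<Prod>j\<in>J. c j) = (\<Prod>j\<in>J. sqrt (c j))" for c :: "'i \<Rightarrow> real"
      by (induction J rule: infinite_finite_induct) (auto simp: real_sqrt_mult)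
    ultimately show ?thesis by (simp add: prod.distrib[symmetric])
  qed
  also have "\<dots> \<le> (\<Prod>j\<in>J. ((a j + b j) / 2) powr \<alpha> j)"
    using assms(1-3) arith_geo_mean_sqrt
    by (intro prod_mono conjI powr_mono2) (auto simp: less_imp_le)
  finally show ?thesis .
qed

lemma weak_factors_midpoint:
  assumes \<alpha>: "\<And>j. j \<in> J \<Longrightarrow> \<alpha> j > 0"
    and G: "\<And>j. j \<in> J \<Longrightarrow> G j \<subseteq> nonneg_measurable M"
    and A: "A \<ge> 0" and K: "K \<ge> 1"
    and \<phi>: "\<phi> \<in> weak_factors M J \<alpha> G A g K" and \<psi>: "\<psi> \<in> weak_factors M J \<alpha> G A g K"
  shows "(\<lambda>j x. (\<phi> j x + \<psi> j x) / 2) \<in> weak_factors M J \<alpha> G A g K"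
proof -
  have \<phi>_nm: "\<phi> j \<in> nonneg_measurable M" and \<psi>_nm: "\<psi> j \<in> nonneg_measurable M"
    if "j \<in> J" for j
    using that \<phi> \<psi> by (auto simp: weak_factors_def)
  have \<phi>nm: "\<phi> j \<in> borel_measurable M" "\<And>x. x \<in> space M \<Longrightarrow> 0 \<le> \<phi> j x"
    and \<psi>nm: "\<psi> j \<in> borel_measurable M" "\<And>x. x \<in> space M \<Longrightarrow> 0 \<le> \<psi> j x"
    if "j \<in> J" for j
    using \<phi>_nm[OF that] \<psi>_nm[OF that] by (auto simp: nonneg_measurable_def)
  show ?thesis
    unfolding weak_factors_def mem_Collect_eq
  proof (intro conjI ballI impI)
    fix j assume j: "j \<in> J"
    show "(\<lambda>x. (\<phi> j x + \<psi> j x) / 2) \<in> nonneg_measurable M"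
      using \<phi>nm[OF j] \<psi>nm[OF j] by (auto simp: nonneg_measurable_def)
  next
    fix x assume x: "x \<in> space M" and pos: "\<forall>j\<in>J. 0 < g j x"
    show "1 \<le> (\<Prod>j\<in>J. ((\<phi> j x + \<psi> j x) / 2) powr \<alpha> j)"
      using \<phi> \<psi> x pos \<alpha> \<phi>nm(2) \<psi>nm(2)
      by (intro prod_powr_midpoint_ge_1) (auto simp: weak_factors_def)
  next
    fix j h assume j: "j \<in> J" and h: "h \<in> G j" and le: "\<forall>x\<in>space M. h x \<le> K * g j x"
    have hm: "h \<in> borel_measurable M" and h0: "\<And>x. x \<in> space M \<Longrightarrow> 0 \<le> h x"
      using h G[OF j] unfolding nonneg_measurable_def by blast+
    have 1: "(\<integral>\<^sup>+ x. ennreal (h x * \<phi> j x) \<partial>M) \<le> ennreal (A + 1 / K)"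
      and 2: "(\<integral>\<^sup>+ x. ennreal (h x * \<psi> j x) \<partial>M) \<le> ennreal (A + 1 / K)"
      using \<phi> \<psi> j h le by (auto simp: weak_factors_def)
    have "(\<integral>\<^sup>+ x. ennreal (h x * ((\<phi> j x + \<psi> j x) / 2)) \<partial>M)
        = (\<integral>\<^sup>+ x. ennreal (1/2) * (ennreal (h x * \<phi> j x) + ennreal (h x * \<psi> j x)) \<partial>M)"
    proof (rule nn_integral_cong)
      fix x assume x: "x \<in> space M"
      have "h x * ((\<phi> j x + \<psi> j x) / 2) = 1/2 * (h x * \<phi> j x + h x * \<psi> j x)"
        by (simp add: field_simps)
      moreover have "0 \<le> h x * \<phi> j x" "0 \<le> h x * \<psi> j x"
        using h0[OF x] \<phi>nm(2)[OF j x] \<psi>nm(2)[OF j x] by simp_all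
      ultimately show "ennreal (h x * ((\<phi> j x + \<psi> j x) / 2))
          = ennreal (1/2) * (ennreal (h x * \<phi> j x) + ennreal (h x * \<psi> j x))"
        by (simp only: ennreal_plus[symmetric] ennreal_mult'[symmetric])
    qed
    also have "\<dots> = ennreal (1/2) *
        ((\<integral>\<^sup>+ x. ennreal (h x * \<phi> j x) \<partial>M) + (\<integral>\<^sup>+ x. ennreal (h x * \<psi> j x) \<partial>M))"
      using hm \<phi>nm(1)[OF j] \<psi>nm(1)[OF j]
      by (simp add: nn_integral_cmult nn_integral_add)
    also have "\<dots> \<le> ennreal (1/2) * (ennreal (A + 1 / K) + ennreal (A + 1 / K))"
      by (intro mult_left_mono add_mono 1 2) auto
    also have "\<dots> = ennreal (A + 1 / K)"
    proof -
      have "0 \<le> A + 1 / K" using A K by simp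
      then show ?thesis by (simp only: ennreal_plus[symmetric] ennreal_mult'[symmetric]) simp
    qed
    finally show "(\<integral>\<^sup>+ x. ennreal (h x * ((\<phi> j x + \<psi> j x) / 2)) \<partial>M) \<le> ennreal (A + 1 / K)" .
  qed
qed

lemma weak_factors_antimono:
  assumes G: "\<And>j. j \<in> J \<Longrightarrow> G j \<subseteq> nonneg_measurable M" and K: "K \<ge> 1"
    and g: "\<And>j. j \<in> J \<Longrightarrow> g j \<in> G j"
    and le: "\<And>j x. \<lbrakk>j \<in> J; x \<in> space M\<rbrakk> \<Longrightarrow> g j x \<le> 2 * g' j x" and K': "2 * K \<le> K'"
  shows "weak_factors M J \<alpha> G A g' K' \<subseteq> weak_factors M J \<alpha> G A g K"
proof
  fix \<phi> assume \<phi>: "\<phi> \<in> weak_factors M J \<alpha> G A g' K'"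
  have g0: "0 \<le> g j x" if "j \<in> J" "x \<in> space M" for j x
    using g[OF that(1)] G[OF that(1)] that(2) unfolding nonneg_measurable_def by blast
  show "\<phi> \<in> weak_factors M J \<alpha> G A g K"
    unfolding weak_factors_def mem_Collect_eq
  proof (intro conjI ballI impI)
    show "\<phi> j \<in> nonneg_measurable M" if "j \<in> J" for j
      using \<phi> that by (simp add: weak_factors_def)
  next
    fix x assume x: "x \<in> space M" and pos: "\<forall>j\<in>J. 0 < g j x"
    have "0 < g' j x" if "j \<in> J" for j
      using le[OF that x] pos that by fastforce
    then show "1 \<le> (\<Prod>j\<in>J. \<phi> j x powr \<alpha> j)"
      using \<phi> x by (simp add: weak_factors_def)
  next
    fix j h assume j: "j \<in> J" and h: "h \<in> G j" and hle: "\<forall>x\<in>space M. h x \<le> K * g j x"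
    have "h x \<le> K' * g' j x" if x: "x \<in> space M" for x
    proof -
      have "g' j x \<ge> 0" using le[OF j x] g0[OF j x] by linarith
      have "K * g j x \<le> K * (2 * g' j x)" using le[OF j x] K by (intro mult_left_mono) auto
      also have "\<dots> = (2 * K) * g' j x" by simp
      also have "\<dots> \<le> K' * g' j x" using K' \<open>g' j x \<ge> 0\<close> by (rule mult_right_mono)
      finally show ?thesis using hle x by fastforce
    qed
    then have "(\<integral>\<^sup>+ x. ennreal (h x * \<phi> j x) \<partial>M) \<le> ennreal (A + 1 / K')"
      using \<phi> j h by (simp add: weak_factors_def)
    also have "\<dots> \<le> ennreal (A + 1 / K)"
      using K K' by (intro ennreal_leI add_left_mono divide_left_mono) auto
    finally show "(\<integral>\<^sup>+ x. ennreal (h x * \<phi> j x) \<partial>M) \<le> ennreal (A + 1 / K)" .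
  qed
qed

section \<open>Common limits of directed families of convex sets\<close>

text \<open>
  The pointwise inequality \<open>\<bar>v\<bar> \<le> (1/2) ^ n + 2 ^ n * v\<^sup>2\<close> turns the decay of the mean squares
  into geometric decay of the mean of \<open>\<bar>w n\<bar>\<close>, so that the sum of these means is finite.
\<close>

lemma AE_summable_of_fast_L2_decay:
  fixes w :: "nat \<Rightarrow> 'a \<Rightarrow> real"
  assumes "finite_measure P"
    and w [measurable]: "\<And>n. w n \<in> borel_measurable P"
    and int: "\<And>n. integrable P (\<lambda>x. (w n x)\<^sup>2)"
    and decay: "\<And>n. (\<integral>x. (w n x)\<^sup>2 \<partial>P) \<le> c * (1/4) ^ n"
  shows "AE x in P. summable (\<lambda>n. \<bar>w n x\<bar>)"
proof -
  interpret finite_measure P by fact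
  define C where "C = measure P (space P) + c"
  have "0 \<le> (\<integral>x. (w 0 x)\<^sup>2 \<partial>P)" by simp
  also have "\<dots> \<le> c" using decay[of 0] by simp
  finally have "C \<ge> 0" by (simp add: C_def)
  have bound: "(\<integral>\<^sup>+ x. ennreal \<bar>w n x\<bar> \<partial>P) \<le> ennreal (C * (1/2) ^ n)" for n
  proof -
    have pt: "\<bar>v\<bar> \<le> (1/2) ^ n + 2 ^ n * v\<^sup>2" for v :: real
    proof (cases "\<bar>v\<bar> \<le> (1/2) ^ n")
      case True then show ?thesis by (simp add: add_increasing2)
    next
      case False
      then have "1 \<le> 2 ^ n * \<bar>v\<bar>" by (simp add: power_divide field_simps)
      then have "1 * \<bar>v\<bar> \<le> (2 ^ n * \<bar>v\<bar>) * \<bar>v\<bar>" by (rule mult_right_mono) simp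
      also have "\<dots> = 2 ^ n * v\<^sup>2" by (simp add: power2_eq_square mult.assoc)
      also have "\<dots> \<le> (1/2) ^ n + 2 ^ n * v\<^sup>2" by simp
      finally show ?thesis by simp
    qed
    have "(\<integral>\<^sup>+ x. ennreal \<bar>w n x\<bar> \<partial>P) \<le> (\<integral>\<^sup>+ x. ennreal ((1/2) ^ n + 2 ^ n * (w n x)\<^sup>2) \<partial>P)"
      by (intro nn_integral_mono ennreal_leI pt)
    also have "\<dots> = ennreal (\<integral>x. (1/2) ^ n + 2 ^ n * (w n x)\<^sup>2 \<partial>P)"
      using int by (intro nn_integral_eq_integral) auto
    also have "(\<integral>x. (1/2) ^ n + 2 ^ n * (w n x)\<^sup>2 \<partial>P)
        = (1/2) ^ n * measure P (space P) + 2 ^ n * (\<integral>x. (w n x)\<^sup>2 \<partial>P)"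
      using int by simp
    also have "\<dots> \<le> (1/2) ^ n * measure P (space P) + 2 ^ n * (c * (1/4) ^ n)"
      using decay[of n] by simp
    also have "\<dots> = C * (1/2) ^ n"
    proof -
      have "(2::real) ^ n * (1/4) ^ n = (1/2) ^ n"
        by (simp flip: power_mult_distrib)
      then show ?thesis by (simp add: C_def algebra_simps)
    qed
    finally show ?thesis by (simp add: ennreal_leI)
  qed
  have "(\<integral>\<^sup>+ x. (\<Sum>n. ennreal \<bar>w n x\<bar>) \<partial>P) = (\<Sum>n. \<integral>\<^sup>+ x. ennreal \<bar>w n x\<bar> \<partial>P)"
    by (intro nn_integral_suminf) measurable
  also have "\<dots> \<le> (\<Sum>n. ennreal (C * (1/2) ^ n))"
    by (intro suminf_le bound) auto
  also have "\<dots> = ennreal (\<Sum>n. C * (1/2) ^ n)"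
    using \<open>C \<ge> 0\<close> by (intro suminf_ennreal2 summable_mult summable_geometric) auto
  also have "\<dots> < \<infinity>" by simp
  finally have "AE x in P. (\<Sum>n. ennreal \<bar>w n x\<bar>) \<noteq> \<infinity>"
    by (intro nn_integral_PInf_AE) auto
  then show ?thesis
    by eventually_elim (auto intro: summable_suminf_not_top)
qed

text \<open>
  Let \<open>m C\<close> be the infimum of \<open>\<Psi>\<close> over \<open>C\<close>, and \<open>s\<close> the supremum of \<open>m C\<close> over the family.
  Choose \<open>C n\<close> with \<open>m (C n) > s - (1/4) ^ n\<close>.  By directedness, every member \<open>D\<close> meets \<open>C n\<close>
  in a point with \<open>\<Psi> < s + (1/4) ^ n\<close>.  Any two such points have their midpoint in \<open>C n\<close>, where
  \<open>\<Psi>\<close> is at least \<open>s - (1/4) ^ n\<close>, and are therefore close by uniform convexity.  Applied with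
  \<open>D = C (Suc n)\<close> this produces a convergent sequence \<open>f\<close>; applied with an arbitrary \<open>D\<close> it
  produces a sequence in \<open>D\<close> with the same limit.  The conclusion speaks of \<open>exp (- \<phi> / 2)\<close>
  because \<open>\<phi>\<close> itself may tend to infinity.
\<close>

lemma directed_convex_family_common_limit:
  fixes \<C> :: "('i \<Rightarrow> 'a \<Rightarrow> real) set set"
  assumes P: "finite_measure P" and J: "finite J" and ne: "\<C> \<noteq> {}"
    and C_ne: "\<And>C. C \<in> \<C> \<Longrightarrow> C \<noteq> {}"
    and C_meas: "\<And>C \<phi> j. \<lbrakk>C \<in> \<C>; \<phi> \<in> C; j \<in> J\<rbrakk> \<Longrightarrow> \<phi> j \<in> nonneg_measurable P"
    and C_mid: "\<And>C \<phi> \<psi>. \<lbrakk>C \<in> \<C>; \<phi> \<in> C; \<psi> \<in> C\<rbrakk> \<Longrightarrow> (\<lambda>j x. (\<phi> j x + \<psi> j x) / 2) \<in> C"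
    and directed: "\<And>C D. \<lbrakk>C \<in> \<C>; D \<in> \<C>\<rbrakk> \<Longrightarrow> \<exists>E\<in>\<C>. E \<subseteq> C \<inter> D"
  obtains u :: "'i \<Rightarrow> 'a \<Rightarrow> real" where "\<And>j. j \<in> J \<Longrightarrow> u j \<in> borel_measurable P"
    "\<And>C. C \<in> \<C> \<Longrightarrow> \<exists>f. (\<forall>n. f n \<in> C) \<and>
      (AE x in P. \<forall>j\<in>J. (\<lambda>n. exp (- f n j x / 2)) \<longlonglongrightarrow> u j x)"
proof -
  interpret finite_measure P by (rule P)
  define \<Psi> where "\<Psi> \<phi> = (\<Sum>j\<in>J. \<integral>x. exp (- \<phi> j x) \<partial>P)" for \<phi> :: "'i \<Rightarrow> 'a \<Rightarrow> real"
  have int: "integrable P (\<lambda>x. exp (- f x))" if "f \<in> nonneg_measurable P" for f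
    using that by (intro integrable_const_bound[of _ 1]) (auto simp: nonneg_measurable_def)
  have nn_mid: "(\<lambda>x. (f x + g x) / 2) \<in> nonneg_measurable P"
    if "f \<in> nonneg_measurable P" "g \<in> nonneg_measurable P" for f g
    using that by (auto simp: nonneg_measurable_def)
  define m where "m C = (INF \<phi>\<in>C. \<Psi> \<phi>)" for C
  have \<Psi>0: "0 \<le> \<Psi> \<phi>" for \<phi>
    unfolding \<Psi>_def by (intro sum_nonneg integral_nonneg) auto
  have \<Psi>_bdd: "bdd_below (\<Psi> ` C)" for C
    by (rule bdd_belowI2) (rule \<Psi>0)
  have \<Psi>_le: "\<Psi> \<phi> \<le> (\<Sum>j\<in>J. measure P (space P))" if "C \<in> \<C>" "\<phi> \<in> C" for C \<phi>
    unfolding \<Psi>_def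
  proof (rule sum_mono)
    fix j assume j: "j \<in> J"
    have "(\<integral>x. exp (- \<phi> j x) \<partial>P) \<le> (\<integral>x. 1 \<partial>P)"
      using C_meas[OF that j] int by (intro integral_mono) (auto simp: nonneg_measurable_def)
    then show "(\<integral>x. exp (- \<phi> j x) \<partial>P) \<le> measure P (space P)" by simp
  qed
  have m_le: "m C \<le> \<Psi> \<phi>" if "\<phi> \<in> C" for C \<phi>
    unfolding m_def by (rule cINF_lower[OF \<Psi>_bdd that])
  define s where "s = (SUP C\<in>\<C>. m C)"
  have bdd: "bdd_above (m ` \<C>)"
  proof (rule bdd_aboveI2)
    fix C assume C: "C \<in> \<C>"
    then obtain \<phi> where "\<phi> \<in> C" using C_ne by blast
    then show "m C \<le> (\<Sum>j\<in>J. measure P (space P))"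
      using m_le \<Psi>_le[OF C] by fastforce
  qed
  have "\<exists>C\<in>\<C>. s - (1/4) ^ n < m C" for n
    using less_cSUP_iff[OF ne bdd, of "s - (1/4) ^ n"] unfolding s_def by simp
  then obtain C where C: "\<And>n. C n \<in> \<C>" "\<And>n. s - (1/4) ^ n < m (C n)" by metis
  \<comment> \<open>A subset \<open>E\<close> of \<open>C n \<inter> D\<close> in the family has \<open>m E \<le> s\<close>, however small it is.\<close>
  have near: "\<exists>\<phi>\<in>C n \<inter> D. \<Psi> \<phi> < s + (1/4) ^ n" if D: "D \<in> \<C>" for n D
  proof -
    obtain E where E: "E \<in> \<C>" "E \<subseteq> C n \<inter> D" using directed[OF C(1) D] by blast
    have "m E \<le> s" unfolding s_def by (rule cSUP_upper[OF E(1) bdd])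
    then have "(INF \<phi>\<in>E. \<Psi> \<phi>) < s + (1/4) ^ n"
      unfolding m_def using zero_less_power[of "1/4::real" n] by linarith
    then show ?thesis
      using cINF_less_iff[OF C_ne[OF E(1)] \<Psi>_bdd] E(2) by blast
  qed
  \<comment> \<open>Uniform convexity: with \<open>\<xi>\<close> the midpoint of \<open>\<phi>\<close> and \<open>\<psi>\<close>, the squared differences
    sum to \<open>\<Psi> \<phi> + \<Psi> \<psi> - 2 * \<Psi> \<xi>\<close>.\<close>
  have close: "(\<integral>x. (exp (- \<phi> j x / 2) - exp (- \<psi> j x / 2))\<^sup>2 \<partial>P) \<le> 4 * (1/4) ^ n"
      "integrable P (\<lambda>x. (exp (- \<phi> j x / 2) - exp (- \<psi> j x / 2))\<^sup>2)"
    if *: "\<phi> \<in> C n" "\<psi> \<in> C n" "\<Psi> \<phi> < s + (1/4) ^ n" "\<Psi> \<psi> < s + (1/4) ^ n" and j: "j \<in> J"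
    for \<phi> \<psi> j n
  proof -
    define \<xi> where "\<xi> j x = (\<phi> j x + \<psi> j x) / 2" for j x
    have \<xi>: "\<xi> \<in> C n" unfolding \<xi>_def by (rule C_mid[OF C(1) *(1,2)])
    define D where "D j x = (exp (- \<phi> j x / 2) - exp (- \<psi> j x / 2))\<^sup>2" for j x
    have D: "D j x = exp (- \<phi> j x) + exp (- \<psi> j x) - 2 * exp (- \<xi> j x)" for j x
      by (simp add: D_def \<xi>_def power2_diff add_divide_distrib flip: exp_double exp_add)
    have i: "integrable P (\<lambda>x. exp (- \<phi> j x))" "integrable P (\<lambda>x. exp (- \<psi> j x))"
        "integrable P (\<lambda>x. exp (- \<xi> j x))" if "j \<in> J" for j
      using that *(1,2) \<xi> C(1) C_meas int by blast+
    have Di: "integrable P (D j)" if "j \<in> J" for j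
      unfolding D using i[OF that] by simp
    show "integrable P (\<lambda>x. (exp (- \<phi> j x / 2) - exp (- \<psi> j x / 2))\<^sup>2)"
      using Di[OF j] unfolding D_def[abs_def] .
    have "(\<integral>x. D j x \<partial>P) \<le> (\<Sum>j\<in>J. \<integral>x. D j x \<partial>P)"
      using J j by (intro member_le_sum) (auto simp: D_def)
    also have "\<dots> = (\<Sum>j\<in>J. (\<integral>x. exp (- \<phi> j x) \<partial>P) + (\<integral>x. exp (- \<psi> j x) \<partial>P)
        - 2 * (\<integral>x. exp (- \<xi> j x) \<partial>P))"
      unfolding D using i by (intro sum.cong) auto
    also have "\<dots> = \<Psi> \<phi> + \<Psi> \<psi> - 2 * \<Psi> \<xi>"
      by (simp add: \<Psi>_def sum.distrib sum_subtractf sum_distrib_left)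
    also have "\<dots> \<le> 4 * (1/4) ^ n"
      using m_le[OF \<xi>] C(2)[of n] *(3,4) by linarith
    finally show "(\<integral>x. (exp (- \<phi> j x / 2) - exp (- \<psi> j x / 2))\<^sup>2 \<partial>P) \<le> 4 * (1/4) ^ n"
      by (simp add: D_def)
  qed
  have "\<exists>\<phi>. \<phi> \<in> C n \<inter> C (Suc n) \<and> \<Psi> \<phi> < s + (1/4) ^ Suc n" for n
    using near[OF C(1)[of n], of "Suc n"] by blast
  then obtain f where f: "\<And>n. f n \<in> C n" "\<And>n. f n \<in> C (Suc n)"
      "\<And>n. \<Psi> (f n) < s + (1/4) ^ Suc n"
    by (metis Int_iff)
  have f': "\<Psi> (f n) < s + (1/4) ^ n" for n
  proof -
    have "(1/4::real) ^ Suc n \<le> (1/4) ^ n" by (rule power_decreasing) auto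
    then show ?thesis using f(3)[of n] by linarith
  qed
  have meas: "f n j \<in> borel_measurable P" if "j \<in> J" for n j
    using C_meas[OF C(1) f(1) that] by (simp add: nonneg_measurable_def)
  define U where "U n j x = exp (- f n j x / 2)" for n j x
  have U_meas [measurable]: "U n j \<in> borel_measurable P" if "j \<in> J" for n j
    unfolding U_def using meas[OF that] by measurable
  define u where "u j x = lim (\<lambda>n. U n j x)" for j x
  have U_conv: "AE x in P. (\<lambda>n. U n j x) \<longlonglongrightarrow> u j x" if j: "j \<in> J" for j
  proof -
    have dec: "(\<integral>x. (U (Suc n) j x - U n j x)\<^sup>2 \<partial>P) \<le> 1 * (1/4) ^ n"
        "integrable P (\<lambda>x. (U (Suc n) j x - U n j x)\<^sup>2)" for n
    proof -
      have "f (Suc n) \<in> C (Suc n)" "f n \<in> C (Suc n)" using f by auto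
      from close[OF this f' f(3) j]
      show "(\<integral>x. (U (Suc n) j x - U n j x)\<^sup>2 \<partial>P) \<le> 1 * (1/4) ^ n"
        "integrable P (\<lambda>x. (U (Suc n) j x - U n j x)\<^sup>2)" by (simp_all add: U_def)
    qed
    have "AE x in P. summable (\<lambda>n. \<bar>U (Suc n) j x - U n j x\<bar>)"
      using j by (intro AE_summable_of_fast_L2_decay[OF P _ dec(2) dec(1)]) measurable
    then show ?thesis
    proof eventually_elim
      case (elim x)
      then have "summable (\<lambda>n. U (Suc n) j x - U n j x)"
        by (rule summable_rabs_cancel)
      then have "convergent (\<lambda>n. U n j x)" by (simp only: summable_iff_convergent sum_lessThan_telescope[of "\<lambda>n. U n j x"]
            convergent_diff_const_right_iff)
      then show ?case by (simp add: u_def convergent_LIMSEQ_iff)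
    qed
  qed
  show thesis
  proof (rule that)
    show "u j \<in> borel_measurable P" if "j \<in> J" for j
      unfolding u_def using U_meas[OF that] by measurable
  next
    fix D assume D: "D \<in> \<C>"
    have "\<exists>\<phi>. \<phi> \<in> C n \<inter> D \<and> \<Psi> \<phi> < s + (1/4) ^ n" for n
      using near[OF D, of n] by blast
    then obtain g where g: "\<And>n. g n \<in> C n" "\<And>n. g n \<in> D" "\<And>n. \<Psi> (g n) < s + (1/4) ^ n"
      by (metis Int_iff)
    have "AE x in P. (\<lambda>n. exp (- g n j x / 2)) \<longlonglongrightarrow> u j x" if j: "j \<in> J" for j
    proof -
      have gm: "g n j \<in> borel_measurable P" for n
        using C_meas[OF D g(2) j] by (simp add: nonneg_measurable_def)
      have "AE x in P. summable (\<lambda>n. \<bar>exp (- g n j x / 2) - exp (- f n j x / 2)\<bar>)"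
      proof (rule AE_summable_of_fast_L2_decay[OF P _ close(2)[OF g(1) f(1) g(3) f' j]
            close(1)[OF g(1) f(1) g(3) f' j]])
        show "(\<lambda>x. exp (- g n j x / 2) - exp (- f n j x / 2)) \<in> borel_measurable P" for n
          using gm[of n] meas[OF j, of n] by measurable
      qed
      with U_conv[OF j] show ?thesis
      proof eventually_elim
        case (elim x)
        have "(\<lambda>n. exp (- g n j x / 2) - U n j x) \<longlonglongrightarrow> 0"
          using summable_LIMSEQ_zero[OF summable_rabs_cancel[OF elim(2)]] by (simp add: U_def)
        from tendsto_add[OF this elim(1)] show ?case by simp
      qed
    qed
    then have "AE x in P. \<forall>j\<in>J. (\<lambda>n. exp (- g n j x / 2)) \<longlonglongrightarrow> u j x"
      using J by (simp add: AE_ball_countable countable_finite)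
    with g(2) show "\<exists>f. (\<forall>n. f n \<in> D) \<and>
        (AE x in P. \<forall>j\<in>J. (\<lambda>n. exp (- f n j x / 2)) \<longlonglongrightarrow> u j x)" by blast
  qed
qed

section \<open>Consequences of saturation and of Fatou's lemma\<close>

text \<open>
  The positivity conditions are removed one index at a time.  If \<open>N\<close> is null on the set where
  \<open>f\<close> and all \<open>g j\<close>, \<open>j \<in> J\<close>, are positive, for every \<open>f \<in> G i\<close>, then every \<open>f \<in> G i\<close>
  vanishes almost everywhere on the part of \<open>N\<close> where all \<open>g j\<close> are positive, which is therefore
  null.  This avoids the choice of a countable subfamily whose supports exhaust the space.
\<close>

lemma saturating_joint_support:
  assumes "finite J" and sat: "\<And>j. j \<in> J \<Longrightarrow> saturating M (G j)"
    and G: "\<And>j. j \<in> J \<Longrightarrow> G j \<subseteq> nonneg_measurable M"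
    and N: "N \<in> sets M"
    and null: "\<And>g. (\<And>j. j \<in> J \<Longrightarrow> g j \<in> G j) \<Longrightarrow>
      AE x in M. (\<forall>j\<in>J. 0 < g j x) \<longrightarrow> x \<notin> N"
  shows "AE x in M. x \<notin> N"
  using assms
proof (induction J rule: finite_induct)
  case empty
  then show ?case by simp
next
  case (insert i J)
  have "AE x in M. (\<forall>j\<in>J. 0 < g j x) \<longrightarrow> x \<notin> N" if g: "\<And>j. j \<in> J \<Longrightarrow> g j \<in> G j" for g
  proof -
    define E where "E = {x \<in> space M. x \<in> N \<and> (\<forall>j\<in>J. 0 < g j x)}"
    have gm: "g j \<in> borel_measurable M" if "j \<in> J" for j
      using g[OF that] insert.prems(2)[of j] that unfolding nonneg_measurable_def by blast
    have E: "E \<in> sets M"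
      unfolding E_def using insert.prems(3) insert.hyps(1) gm by measurable
    have "AE x in M. x \<in> E \<longrightarrow> f x = 0" if f: "f \<in> G i" for f
    proof -
      have "AE x in M. (\<forall>j\<in>insert i J. 0 < (g(i := f)) j x) \<longrightarrow> x \<notin> N"
        using f g by (intro insert.prems(4)) auto
      then show ?thesis
      proof (rule AE_mp, intro AE_I2 impI)
        fix x assume x: "x \<in> space M" "x \<in> E"
          and imp: "(\<forall>j\<in>insert i J. 0 < (g(i := f)) j x) \<longrightarrow> x \<notin> N"
        have "0 \<le> f x" using f x(1) insert.prems(2)[of i] unfolding nonneg_measurable_def by blast
        moreover have "\<not> 0 < f x"
        proof
          assume "0 < f x"
          then have "0 < (g(i := f)) j x" if "j \<in> insert i J" for j
            using that x(2) by (cases "j = i") (auto simp: E_def)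
          then show False using imp x(2) by (auto simp: E_def)
        qed
        ultimately show "f x = 0" by simp
      qed
    qed
    then have "emeasure M E = 0"
      using insert.prems(1)[of i] E unfolding saturating_def by blast
    then have "AE x in M. x \<notin> E" using E by (intro AE_not_in null_setsI)
    then show ?thesis by (rule AE_mp) (auto simp: E_def)
  qed
  then show ?case using insert by auto
qed

text \<open>
  Where \<open>u\<close> vanishes, \<open>f n\<close> tends to infinity, so \<open>g\<close> must vanish there for the lower limit of
  \<open>g * f n\<close> to have a finite integral.  Elsewhere \<open>f n\<close> tends to \<open>- 2 * ln u\<close>.  The maximum
  with zero changes nothing almost everywhere on the set where \<open>u\<close> is positive; it makes the
  function nonnegative at the exceptional points too.
\<close>

lemma Fatou_for_exp_limits:
  fixes f :: "nat \<Rightarrow> 'a \<Rightarrow> real"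
  assumes g: "g \<in> nonneg_measurable M" and f: "\<And>n. f n \<in> nonneg_measurable M"
    and lim: "AE x in M. (\<lambda>n. exp (- f n x / 2)) \<longlonglongrightarrow> u x"
    and bound: "\<And>n. (\<integral>\<^sup>+ x. ennreal (g x * f n x) \<partial>M) \<le> ennreal B"
  shows "AE x in M. u x \<le> 0 \<longrightarrow> g x = 0"
    and "(\<integral>\<^sup>+ x. ennreal (g x * max 0 (- 2 * ln (u x))) \<partial>M) \<le> ennreal B"
proof -
  define L where "L x = liminf (\<lambda>n. ennreal (g x * f n x))" for x
  have m: "(\<lambda>x. ennreal (g x * f n x)) \<in> borel_measurable M" for n
  proof -
    have "g \<in> borel_measurable M" "f n \<in> borel_measurable M"
      using g f[of n] by (simp_all add: nonneg_measurable_def)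
    then show ?thesis by measurable
  qed
  have "(\<integral>\<^sup>+ x. L x \<partial>M) \<le> liminf (\<lambda>n. \<integral>\<^sup>+ x. ennreal (g x * f n x) \<partial>M)"
    unfolding L_def by (rule nn_integral_liminf) (rule m)
  also have "\<dots> \<le> liminf (\<lambda>n. ennreal B)"
    by (intro Liminf_mono always_eventually allI bound)
  finally have LB: "(\<integral>\<^sup>+ x. L x \<partial>M) \<le> ennreal B" by (simp add: Liminf_const)
  have "AE x in M. L x \<noteq> \<infinity>"
    using LB m by (intro nn_integral_PInf_AE) (auto simp: L_def top_unique)
  then show zero: "AE x in M. u x \<le> 0 \<longrightarrow> g x = 0"
    using lim
  proof (rule AE_mp[OF AE_conjI], intro AE_I2 impI)
    fix x assume x: "x \<in> space M" and u: "u x \<le> 0"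
      and L: "L x \<noteq> \<infinity> \<and> (\<lambda>n. exp (- f n x / 2)) \<longlonglongrightarrow> u x"
    have "u x \<ge> 0" by (rule LIMSEQ_le_const[OF conjunct2[OF L]]) auto
    with u L have "(\<lambda>n. exp (- f n x / 2)) \<longlonglongrightarrow> 0" by simp
    then have "filterlim (\<lambda>n. inverse (exp (- f n x / 2))) at_top sequentially"
      by (intro filterlim_inverse_at_top) auto
    then have "filterlim (\<lambda>n. ln (exp (f n x / 2))) at_top sequentially"
      by (intro filterlim_compose[OF ln_at_top]) (simp add: exp_minus)
    then have top: "filterlim (\<lambda>n. f n x / 2) at_top sequentially" by simp
    show "g x = 0"
    proof (rule ccontr)
      assume "g x \<noteq> 0"
      with g x have "g x > 0" unfolding nonneg_measurable_def by force
      then have "filterlim (\<lambda>n. (2 * g x) * (f n x / 2)) at_top sequentially"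
        by (intro filterlim_tendsto_pos_mult_at_top[OF tendsto_const _ top]) simp
      then have "filterlim (\<lambda>n. g x * f n x) at_top sequentially" by simp
      then have "(\<lambda>n. ennreal (g x * f n x)) \<longlonglongrightarrow> top"
        by (rule filterlim_compose[OF ennreal_tendsto_top_eq_at_top[THEN iffD2, OF filterlim_ident]])
      then have "L x = top" unfolding L_def by (intro lim_imp_Liminf) auto
      then show False using L by simp
    qed
  qed
  have "AE x in M. ennreal (g x * max 0 (- 2 * ln (u x))) \<le> L x"
    using zero lim
  proof (rule AE_mp[OF AE_conjI], intro AE_I2 impI)
    fix x assume x: "x \<in> space M"
      and H: "(u x \<le> 0 \<longrightarrow> g x = 0) \<and> (\<lambda>n. exp (- f n x / 2)) \<longlonglongrightarrow> u x"
    show "ennreal (g x * max 0 (- 2 * ln (u x))) \<le> L x"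
    proof (cases "u x \<le> 0")
      case True then show ?thesis using H by simp
    next
      case False
      then have "(\<lambda>n. - 2 * ln (exp (- f n x / 2))) \<longlonglongrightarrow> - 2 * ln (u x)"
        using H by (intro tendsto_intros) auto
      then have lim: "(\<lambda>n. f n x) \<longlonglongrightarrow> - 2 * ln (u x)" by simp
      moreover have "- 2 * ln (u x) \<ge> 0"
        using f x by (intro LIMSEQ_le_const[OF lim]) (auto simp: nonneg_measurable_def)
      ultimately have "(\<lambda>n. ennreal (g x * f n x)) \<longlonglongrightarrow> ennreal (g x * max 0 (- 2 * ln (u x)))"
        by (intro tendsto_intros) auto
      then show ?thesis unfolding L_def by (simp add: lim_imp_Liminf)
    qed
  qed
  then have "(\<integral>\<^sup>+ x. ennreal (g x * max 0 (- 2 * ln (u x))) \<partial>M) \<le> (\<integral>\<^sup>+ x. L x \<partial>M)"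
    by (rule nn_integral_mono_AE)
  with LB show "(\<integral>\<^sup>+ x. ennreal (g x * max 0 (- 2 * ln (u x))) \<partial>M) \<le> ennreal B" by simp
qed

lemma sigma_finite_equivalent_finite_measure:
  assumes "sigma_finite_measure M"
  obtains P where "finite_measure P" "sets P = sets M"
    "\<And>Q. (AE x in P. Q x) \<longleftrightarrow> (AE x in M. Q x)"
proof -
  interpret sigma_finite_measure M by fact
  obtain w where w: "w \<in> borel_measurable M" "integral\<^sup>N M w \<noteq> \<infinity>"
      "\<And>x. x \<in> space M \<Longrightarrow> 0 < w x"
    using Ex_finite_integrable_function by metis
  show thesis
  proof (rule that[of "density M w"])
    show "finite_measure (density M w)"
      using w by (intro finite_measureI) (simp add: emeasure_density cong: nn_integral_cong)
    show "(AE x in density M w. Q x) \<longleftrightarrow> (AE x in M. Q x)" for Q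
      unfolding AE_density[OF w(1)] using w(3) by (intro AE_cong) auto
  qed simp
qed

section \<open>The factorisation theorem\<close>

text \<open>
  The functions \<open>g\<close> of which all weak factors are made need a member of each \<open>G j\<close>; the case of an
  empty \<open>G j\<close>, which is saturating only if the whole space is null, is left to the final theorem.
\<close>

theorem disentanglement:
  fixes J :: "'i set" and \<alpha> :: "'i \<Rightarrow> real" and G :: "'i \<Rightarrow> ('a \<Rightarrow> real) set"
  assumes M: "sigma_finite_measure M" and J: "finite J"
    and \<alpha>: "\<And>j. j \<in> J \<Longrightarrow> \<alpha> j > 0" "sum \<alpha> J = 1"
    and G: "\<And>j. j \<in> J \<Longrightarrow> G j \<subseteq> nonneg_measurable M"
    and conv: "\<And>j. j \<in> J \<Longrightarrow> convex_functions M (G j)"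
    and sat: "\<And>j. j \<in> J \<Longrightarrow> saturating M (G j)"
    and ne: "\<And>j. j \<in> J \<Longrightarrow> G j \<noteq> {}"
    and A: "A \<ge> 0"
    and bound: "\<And>g. (\<And>j. j \<in> J \<Longrightarrow> g j \<in> G j) \<Longrightarrow>
      (\<integral>\<^sup>+ x. ennreal (\<Prod>j\<in>J. g j x powr \<alpha> j) \<partial>M) \<le> ennreal A"
  obtains \<phi> where "\<And>j. j \<in> J \<Longrightarrow> \<phi> j \<in> nonneg_measurable M"
    "AE x in M. 1 \<le> (\<Prod>j\<in>J. \<phi> j x powr \<alpha> j)"
    "\<And>j g. \<lbrakk>j \<in> J; g \<in> G j\<rbrakk> \<Longrightarrow> (\<integral>\<^sup>+ x. ennreal (g x * \<phi> j x) \<partial>M) \<le> ennreal A"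
proof -
  obtain P where P: "finite_measure P" and sets_P: "sets P = sets M"
    and AE_P: "\<And>Q. (AE x in P. Q x) \<longleftrightarrow> (AE x in M. Q x)"
    by (rule sigma_finite_equivalent_finite_measure[OF M]) (rule that)
  have bm_P: "(borel_measurable P :: ('a \<Rightarrow> real) set) = borel_measurable M"
    by (rule measurable_cong_sets[OF sets_P refl])
  have nm_P: "nonneg_measurable P = nonneg_measurable M"
    by (simp add: nonneg_measurable_def bm_P sets_eq_imp_space_eq[OF sets_P])
  define S where "S = {g. \<forall>j\<in>J. g j \<in> G j}"
  have S_I: "\<exists>g\<in>S. g j = h" if "j \<in> J" "h \<in> G j" for j h
  proof
    show "(\<lambda>k. SOME f. f \<in> G k)(j := h) \<in> S"
      using that ne by (auto simp: S_def some_in_eq)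
  qed simp
  define \<C> where "\<C> = {weak_factors M J \<alpha> G A g K | g K. g \<in> S \<and> 1 \<le> K}"
  have \<C>_I: "weak_factors M J \<alpha> G A g K \<in> \<C>" if "g \<in> S" "1 \<le> K" for g K
    using that by (auto simp: \<C>_def)
  obtain u where u_m: "\<And>j. j \<in> J \<Longrightarrow> u j \<in> borel_measurable P"
    and u: "\<And>C. C \<in> \<C> \<Longrightarrow> \<exists>f. (\<forall>n. f n \<in> C) \<and>
      (AE x in P. \<forall>j\<in>J. (\<lambda>n. exp (- f n j x / 2)) \<longlonglongrightarrow> u j x)"
  proof (rule directed_convex_family_common_limit[OF P J, of \<C>])
    have "(\<lambda>k. SOME f. f \<in> G k) \<in> S" using ne by (auto simp: S_def some_in_eq)
    then show "\<C> \<noteq> {}" using \<C>_I[of _ 1] by fastforce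
    show "C \<noteq> {}" if "C \<in> \<C>" for C
    proof -
      obtain g K where C: "C = weak_factors M J \<alpha> G A g K" and gK: "g \<in> S" "1 \<le> K"
        using \<open>C \<in> \<C>\<close> by (auto simp: \<C>_def)
      show ?thesis
        unfolding C using gK by (intro weak_factors_nonempty J \<alpha> G conv bound A) (auto simp: S_def)
    qed
    show "\<phi> j \<in> nonneg_measurable P" if "C \<in> \<C>" "\<phi> \<in> C" "j \<in> J" for C \<phi> j
      using that by (auto simp: \<C>_def weak_factors_def nm_P)
    show "(\<lambda>j x. (\<phi> j x + \<psi> j x) / 2) \<in> C" if "C \<in> \<C>" "\<phi> \<in> C" "\<psi> \<in> C" for C \<phi> \<psi>
      using that \<alpha> G A by (auto simp: \<C>_def intro!: weak_factors_midpoint)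
    show "\<exists>E\<in>\<C>. E \<subseteq> C \<inter> D" if C: "C \<in> \<C>" and D: "D \<in> \<C>" for C D
    proof -
      obtain g K g' K' where C: "C = weak_factors M J \<alpha> G A g K" "g \<in> S" "1 \<le> K"
        and D: "D = weak_factors M J \<alpha> G A g' K'" "g' \<in> S" "1 \<le> K'"
        using C D by (auto simp: \<C>_def)
      have "\<exists>f\<in>G j. \<forall>x\<in>space M. f x = 1/2 * g j x + 1/2 * g' j x" if "j \<in> J" for j
        using conv[OF that, unfolded convex_functions_def, rule_format, of "g j" "g' j" "1/2" "1/2"]
          C(2) D(2) that by (simp add: S_def)
      then obtain f where f: "\<And>j. j \<in> J \<Longrightarrow> f j \<in> G j"
        "\<And>j x. \<lbrakk>j \<in> J; x \<in> space M\<rbrakk> \<Longrightarrow> f j x = 1/2 * g j x + 1/2 * g' j x"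
        by metis
      have nn: "0 \<le> g j x" "0 \<le> g' j x" if "j \<in> J" "x \<in> space M" for j x
        using C(2) D(2) G[OF that(1)] that unfolding S_def nonneg_measurable_def by blast+
      define K2 where "K2 = 2 * max K K'"
      have "weak_factors M J \<alpha> G A f K2 \<subseteq> C"
        unfolding C(1) using C(2,3) f(2) nn(2)
        by (intro weak_factors_antimono G) (auto simp: S_def K2_def)
      moreover have "weak_factors M J \<alpha> G A f K2 \<subseteq> D"
        unfolding D(1) using D(2,3) f(2) nn(1)
        by (intro weak_factors_antimono G) (auto simp: S_def K2_def)
      moreover have "weak_factors M J \<alpha> G A f K2 \<in> \<C>"
        using f(1) C(3) by (intro \<C>_I) (auto simp: S_def K2_def)
      ultimately show ?thesis by blast
    qed
  qed (rule that)
  have approx: "\<exists>f. (\<forall>n. f n \<in> weak_factors M J \<alpha> G A g K) \<and>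
      (AE x in M. \<forall>j\<in>J. (\<lambda>n. exp (- f n j x / 2)) \<longlonglongrightarrow> u j x)" if "g \<in> S" "1 \<le> K" for g K
    using u[OF \<C>_I[OF that]] by (simp add: AE_P)
  define \<phi> where "\<phi> j x = max 0 (- 2 * ln (u j x))" for j x
  have u_M: "u j \<in> borel_measurable M" if "j \<in> J" for j
    using u_m[OF that] by (simp add: bm_P)
  have \<phi>_nm: "\<phi> j \<in> nonneg_measurable M" if "j \<in> J" for j
    using u_M[OF that] unfolding nonneg_measurable_def \<phi>_def by auto
  have each: "AE x in M. u j x \<le> 0 \<longrightarrow> h x = 0"
      "(\<integral>\<^sup>+ x. ennreal (h x * \<phi> j x) \<partial>M) \<le> ennreal (A + 1 / K)"
    if j: "j \<in> J" and h: "h \<in> G j" and K: "1 \<le> K" for j h K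
  proof -
    obtain g where g: "g \<in> S" "g j = h" using S_I[OF j h] by blast
    obtain f where f: "\<And>n. f n \<in> weak_factors M J \<alpha> G A g K"
      and lim: "AE x in M. \<forall>j\<in>J. (\<lambda>n. exp (- f n j x / 2)) \<longlonglongrightarrow> u j x"
      using approx[OF g(1) K] by blast
    have h_nm: "h \<in> nonneg_measurable M" using G[OF j] h by blast
    have f_nm: "f n j \<in> nonneg_measurable M" for n
      using f[of n] j by (simp add: weak_factors_def)
    have lim_j: "AE x in M. (\<lambda>n. exp (- f n j x / 2)) \<longlonglongrightarrow> u j x"
      using lim by eventually_elim (use j in blast)
    have "h x \<le> K * g j x" if "x \<in> space M" for x
      using h_nm that g(2) K mult_right_mono[of 1 K "h x"] by (simp add: nonneg_measurable_def)
    then have b: "(\<integral>\<^sup>+ x. ennreal (h x * f n j x) \<partial>M) \<le> ennreal (A + 1 / K)" for n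
      using f[of n] j h by (simp add: weak_factors_def)
    show "AE x in M. u j x \<le> 0 \<longrightarrow> h x = 0"
      by (rule Fatou_for_exp_limits(1)[OF h_nm f_nm lim_j b])
    show "(\<integral>\<^sup>+ x. ennreal (h x * \<phi> j x) \<partial>M) \<le> ennreal (A + 1 / K)"
      unfolding \<phi>_def by (rule Fatou_for_exp_limits(2)[OF h_nm f_nm lim_j b])
  qed
  have u_pos: "AE x in M. 0 < u j x" if j: "j \<in> J" for j
  proof -
    define E where "E = {x \<in> space M. u j x \<le> 0}"
    have E: "E \<in> sets M" unfolding E_def using u_M[OF j] by measurable
    have "AE x in M. x \<in> E \<longrightarrow> h x = 0" if h: "h \<in> G j" for h
      using each(1)[OF j h order_refl] by eventually_elim (simp add: E_def)
    then have "emeasure M E = 0" using sat[OF j] E unfolding saturating_def by blast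
    then have "AE x in M. x \<notin> E" using E by (intro AE_not_in null_setsI)
    then show ?thesis by (rule AE_mp) (auto simp: E_def)
  qed
  show thesis
  proof (rule that[of \<phi>])
    fix j h assume j: "j \<in> J" and h: "h \<in> G j"
    show "(\<integral>\<^sup>+ x. ennreal (h x * \<phi> j x) \<partial>M) \<le> ennreal A"
    proof (rule ennreal_le_epsilon)
      fix e :: real assume e: "0 < e"
      \<comment> \<open>The weak factors with \<open>K = max 1 (1 / e)\<close> have allowance at most \<open>e\<close>.\<close>
      have "1 / max 1 (1 / e) \<le> e" using e by (simp add: max_def field_simps)
      then have e': "ennreal (A + 1 / max 1 (1 / e)) \<le> ennreal (A + e)"
        by (intro ennreal_leI) simp
      have "(\<integral>\<^sup>+ x. ennreal (h x * \<phi> j x) \<partial>M) \<le> ennreal (A + 1 / max 1 (1 / e))"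
        by (rule each(2)[OF j h]) simp
      also note e'
      also have "ennreal (A + e) = ennreal A + ennreal e" using A e by simp
      finally show "(\<integral>\<^sup>+ x. ennreal (h x * \<phi> j x) \<partial>M) \<le> ennreal A + ennreal e" .
    qed
  next
    define N where "N = {x \<in> space M. (\<Prod>j\<in>J. \<phi> j x powr \<alpha> j) < 1}"
    have "AE x in M. x \<notin> N"
    proof (rule saturating_joint_support[OF J sat G])
      have "\<phi> j \<in> borel_measurable M" if "j \<in> J" for j
        using \<phi>_nm[OF that] by (simp add: nonneg_measurable_def)
      then show "N \<in> sets M" unfolding N_def by measurable
      fix g assume "\<And>j. j \<in> J \<Longrightarrow> g j \<in> G j"
      then have "g \<in> S" by (simp add: S_def)
      from approx[OF this order_refl] obtain f
        where f: "\<And>n. f n \<in> weak_factors M J \<alpha> G A g 1"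
          and lim: "AE x in M. \<forall>j\<in>J. (\<lambda>n. exp (- f n j x / 2)) \<longlonglongrightarrow> u j x" by blast
      have "AE x in M. \<forall>j\<in>J. 0 < u j x" using J u_pos by (simp add: AE_finite_all)
      with lim show "AE x in M. (\<forall>j\<in>J. 0 < g j x) \<longrightarrow> x \<notin> N"
      proof (rule AE_mp[OF AE_conjI], intro AE_I2 impI)
        fix x assume x: "x \<in> space M" and pos: "\<forall>j\<in>J. 0 < g j x"
          and H: "(\<forall>j\<in>J. (\<lambda>n. exp (- f n j x / 2)) \<longlonglongrightarrow> u j x) \<and> (\<forall>j\<in>J. 0 < u j x)"
        have f0: "0 \<le> f n j x" if "j \<in> J" for n j
          using f[of n] that x by (simp add: weak_factors_def nonneg_measurable_def)
        have lim_f: "(\<lambda>n. f n j x) \<longlonglongrightarrow> \<phi> j x" if j: "j \<in> J" for j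
        proof -
          have "(\<lambda>n. max 0 (- 2 * ln (exp (- f n j x / 2)))) \<longlonglongrightarrow> max 0 (- 2 * ln (u j x))"
            using H j by (intro tendsto_intros) auto
          then show ?thesis using f0[OF j] by (simp add: \<phi>_def)
        qed
        have "(\<lambda>n. \<Prod>j\<in>J. f n j x powr \<alpha> j) \<longlonglongrightarrow> (\<Prod>j\<in>J. \<phi> j x powr \<alpha> j)"
          using f0 \<alpha>(1) by (intro tendsto_prod tendsto_powr2 lim_f tendsto_const) auto
        moreover have "1 \<le> (\<Prod>j\<in>J. f n j x powr \<alpha> j)" for n
          using f[of n] x pos by (simp add: weak_factors_def)
        ultimately have "1 \<le> (\<Prod>j\<in>J. \<phi> j x powr \<alpha> j)"
          by (intro LIMSEQ_le_const) auto
        then show "x \<notin> N" by (simp add: N_def)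
      qed
    qed
    then show "AE x in M. 1 \<le> (\<Prod>j\<in>J. \<phi> j x powr \<alpha> j)"
      by (rule AE_mp) (auto simp: N_def)
  qed (use \<phi>_nm in blast)
qed

theorem theorem1p1:
  fixes M :: "'a measure" and d :: nat and \<alpha> :: "nat \<Rightarrow> real"
    and G :: "nat \<Rightarrow> ('a \<Rightarrow> real) set" and A :: real
  assumes "sigma_finite_measure M"
    and "\<forall>j\<in>{1..d}. \<alpha> j > 0"
    and "(\<Sum>j=1..d. \<alpha> j) = 1"
    and "\<forall>j\<in>{1..d}. G j \<subseteq> nonneg_measurable M"
    and "\<forall>j\<in>{1..d}. convex_functions M (G j)"
    and "\<forall>j\<in>{1..d}. saturating M (G j)"
    and "A \<ge> 0"
    and "\<forall>g :: nat \<Rightarrow> 'a \<Rightarrow> real. (\<forall>j\<in>{1..d}. g j \<in> G j) \<longrightarrow>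
      (\<integral>\<^sup>+ x. ennreal (\<Prod>j=1..d. g j x powr \<alpha> j) \<partial>M) \<le> ennreal A"
  shows "\<exists>\<phi> :: nat \<Rightarrow> 'a \<Rightarrow> real.
    (\<forall>j\<in>{1..d}. \<phi> j \<in> nonneg_measurable M) \<and>
    (AE x in M. (\<Prod>j=1..d. \<phi> j x powr \<alpha> j) \<ge> 1) \<and>
    (\<forall>j\<in>{1..d}. \<forall>g\<in>G j. (\<integral>\<^sup>+ x. ennreal (g x * \<phi> j x) \<partial>M) \<le> ennreal A)"
proof (cases "\<forall>j\<in>{1..d}. G j \<noteq> {}")
  case True
  obtain \<phi> where "\<And>j. j \<in> {1..d} \<Longrightarrow> \<phi> j \<in> nonneg_measurable M"
    "AE x in M. 1 \<le> (\<Prod>j=1..d. \<phi> j x powr \<alpha> j)"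
    "\<And>j g. \<lbrakk>j \<in> {1..d}; g \<in> G j\<rbrakk> \<Longrightarrow> (\<integral>\<^sup>+ x. ennreal (g x * \<phi> j x) \<partial>M) \<le> ennreal A"
    by (rule disentanglement[of M "{1..d}" \<alpha> G A]) (use assms True in auto)
  then show ?thesis by blast
next
  case False
  \<comment> \<open>An empty set of functions vanishes identically on the whole space, which is then null.\<close>
  then obtain j where "j \<in> {1..d}" "G j = {}" by blast
  then have "emeasure M (space M) = 0"
    using assms(6) unfolding saturating_def by blast
  then have null: "space M \<in> null_sets M" by (intro null_setsI) auto
  have AE: "AE x in M. Q x" for Q
    using null by (rule AE_I'[where N = "space M"]) auto
  have "(\<integral>\<^sup>+ x. f x \<partial>M) = 0" for f :: "'a \<Rightarrow> ennreal"
    using nn_integral_cong_AE[OF AE, of f "\<lambda>_. 0"] by simp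
  then show ?thesis
    using AE by (intro exI[of _ "\<lambda>_ _. 1"]) (auto simp: nonneg_measurable_def)
qed

end
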